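(* Let $p$ be a prime and $\lambda$ a partition. The function $[a]\mapsto A_{p,I_\lambda(a)}$ embeds the lattice of $G_{p,\lambda}$-orbits in $A_{p,\lambda}$ into the lattice of characteristic subgroups of $A_{p,\lambda}$ (that is, it is well defined, injective, and a homomorphism of lattices).
   Context: A partition is a non-increasing sequence $\lambda=(\lambda_1\geq\cdots\geq\lambda_l)$ of positive integers; $A_{p,\lambda}=\mathbf{Z}/p^{\lambda_1}\mathbf{Z}\oplus\cdots\oplus\mathbf{Z}/p^{\lambda_l}\mathbf{Z}$; $G_{p,\lambda}$ is the automorphism group of $A_{p,\lambda}$; $[a]$ denotes the $G_{p,\lambda}$-orbit of $a\in A_{p,\lambda}$. A subgroup is characteristic if it is invariant under $G_{p,\lambda}$; characteristic subgroups are ordered by inclusion and form a lattice (meet is intersection, join is sum). For $a,b\in A_{p,\lambda}$ write $[a]\geq[b]$ if there is a homomorphism $\phi:A_{p,\lambda}\to A_{p,\lambda}$ with $\phi(a)=b$. With this relation the set of $G_{p,\lambda}$-orbits in $A_{p,\lambda}$ is a partially ordered set, isomorphic via $[a]\mapsto I_\lambda(a)$ (defined below) to the lattice of ideals of $P_\lambda$ ordered by inclusion; hence it is a lattice. Fundamental poset $P$: its elements are the symbols $(p^r,k)$ with integers $0\leq r<k$, where $(p^r,k)$ denotes the orbit of $p^r$ in $\mathbf{Z}/p^k\mathbf{Z}$ under automorphisms of $\mathbf{Z}/p^k\mathbf{Z}$, i.e. the set of elements $p^ru$ with $p\nmid u$. The partial order is: $(p^r,k)\geq(p^s,l)$ if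 and only if $r\leq s$ and $k-r\geq l-s$ (equivalently, some homomorphism $\mathbf{Z}/p^k\mathbf{Z}\to\mathbf{Z}/p^l\mathbf{Z}$ maps $p^r$ to $p^s$). $P_\lambda$ is the induced subposet consisting of the elements $(p^r,k)$ with $k=\lambda_i$ for some $i$. An ideal of a poset is a (possibly empty) down-closed subset. For $a=(a_1,\ldots,a_l)\in A_{p,\lambda}$, $I(a)$ is the ideal of $P$ generated by the orbits of the non-zero coordinates $a_i\in\mathbf{Z}/p^{\lambda_i}\mathbf{Z}$ ($a_i=p^ru\neq0$ with $p\nmid u$ contributes $(p^r,\lambda_i)$), and $I_\lambda(a)=I(a)\cap P_\lambda$. For an ideal $I\subset P_\lambda$, $A_{p,I}=\{a\in A_{p,\lambda}: I_\lambda(a)\subset I\}$, which is a characteristic subgroup of $A_{p,\lambda}$. *)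

theory Defs
  imports "HOL-Algebra.Product_Groups" "HOL-Algebra.Group_Action" "HOL-Algebra.Lattice"
    "HOL-Computational_Algebra.Primes"
begin

definition is_partition :: "nat list \<Rightarrow> bool" where
  "is_partition lam \<longleftrightarrow> sorted_wrt (\<ge>) lam \<and> (\<forall>k\<in>set lam. 0 < k)"

text \<open>An element \<open>a\<close> has coordinates \<open>a i\<close>, \<open>i < length lam\<close>, each given by its integer
  representative in \<open>{0..<p ^ (lam ! i)}\<close>. The group is written multiplicatively.\<close>

definition abelian_pgroup :: "nat \<Rightarrow> nat list \<Rightarrow> (nat \<Rightarrow> int) monoid" where
  "abelian_pgroup p lam =
     product_group {..<length lam} (\<lambda>i. integer_mod_group (p ^ (lam ! i)))"

definition aut_orbit :: "('a, 'b) monoid_scheme \<Rightarrow> 'a \<Rightarrow> 'a set" where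
  "aut_orbit G a = orbit (AutoGroup G) (\<lambda>f. f) a"

definition orbit_lattice :: "('a, 'b) monoid_scheme \<Rightarrow> 'a set gorder" where
  "orbit_lattice G =
     \<lparr>carrier = orbits (AutoGroup G) (carrier G) (\<lambda>f. f),
      eq = (=),
      le = (\<lambda>U V. \<exists>a\<in>V. \<exists>b\<in>U. \<exists>h\<in>hom G G. h a = b)\<rparr>"

definition characteristic_subgroup :: "'a set \<Rightarrow> ('a, 'b) monoid_scheme \<Rightarrow> bool" where
  "characteristic_subgroup H G \<longleftrightarrow> subgroup H G \<and> (\<forall>f\<in>auto G. f ` H \<subseteq> H)"

definition characteristic_lattice :: "('a, 'b) monoid_scheme \<Rightarrow> 'a set gorder" where
  "characteristic_lattice G =
     \<lparr>carrier = {H. characteristic_subgroup H G}, eq = (=), le = (\<subseteq>)\<rparr>"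

text \<open>The symbol \<open>(p^r, k)\<close> of the fundamental poset is encoded by the pair \<open>(r, k)\<close>;
  neither the set of symbols so encoded nor its order depends on \<open>p\<close>.\<close>

definition fund_poset :: "(nat \<times> nat) gorder" where
  "fund_poset =
     \<lparr>carrier = {(r, k). r < k},
      eq = (=),
      le = (\<lambda>(s, l) (r, k). r \<le> s \<and> l - s \<le> k - r)\<rparr>"

definition fund_poset_part :: "nat list \<Rightarrow> (nat \<times> nat) set" where
  "fund_poset_part lam = {x \<in> carrier fund_poset. snd x \<in> set lam}"

definition generated_order_ideal :: "('a, 'b) gorder_scheme \<Rightarrow> 'a set \<Rightarrow> 'a set" where
  "generated_order_ideal L S = {x \<in> carrier L. \<exists>y\<in>S. x \<sqsubseteq>\<^bsub>L\<^esub> y}"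

definition elt_ideal :: "nat \<Rightarrow> nat list \<Rightarrow> (nat \<Rightarrow> int) \<Rightarrow> (nat \<times> nat) set" where
  "elt_ideal p lam a = generated_order_ideal fund_poset
     {(multiplicity (int p) (a i), lam ! i) | i. i < length lam \<and> a i \<noteq> 0}"

definition elt_ideal_part :: "nat \<Rightarrow> nat list \<Rightarrow> (nat \<Rightarrow> int) \<Rightarrow> (nat \<times> nat) set" where
  "elt_ideal_part p lam a = elt_ideal p lam a \<inter> fund_poset_part lam"

definition ideal_subgroup :: "nat \<Rightarrow> nat list \<Rightarrow> (nat \<times> nat) set \<Rightarrow> (nat \<Rightarrow> int) set" where
  "ideal_subgroup p lam I = {a \<in> carrier (abelian_pgroup p lam). elt_ideal_part p lam a \<subseteq> I}"

text \<open>\<^const>\<open>join_pres\<close> and \<^const>\<open>meet_pres\<close> include the requirement that source and target are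
  lattices.\<close>

definition lattice_embedding ::
    "('a, 'c) gorder_scheme \<Rightarrow> ('b, 'd) gorder_scheme \<Rightarrow> ('a \<Rightarrow> 'b) \<Rightarrow> bool" where
  "lattice_embedding L M f \<longleftrightarrow>
     f \<in> carrier L \<rightarrow> carrier M \<and> inj_on f (carrier L) \<and> join_pres L M f \<and> meet_pres L M f"

end

theory Submission
  imports Defs "HOL-Number_Theory.Cong"
begin

text \<open>A symbol \<open>(p^r, k)\<close> is outside the ideal of \<open>a\<close> iff \<open>a\<close> lies in the fully invariant subgroup
  \<open>p^(r+1) A + A[p^(k-r-1)]\<close>; hence the ideal shrinks under endomorphisms and is constant on
  orbits. Conversely, \<open>a\<close> is carried by an automorphism to a canonical element that depends only on
  its ideal \<open>I\<close>: the one whose coordinate at a part \<open>k\<close> is \<open>p^r\<close> with \<open>r\<close> minimal such that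
  \<open>(p^r, k)\<close> is in \<open>I\<close>, or \<open>0\<close> if there is none. So orbits correspond to ideals, and it remains
  to see that passing from \<open>I\<close> to \<open>A_I\<close> turns intersections into intersections and, by splitting
  an element into its coordinates, unions into sums.\<close>

section \<open>Orders that embed into a lattice of sets\<close>

lemma partial_orderI_subset:
  assumes eq: "eq L = (=)"
    and inj: "inj_on J (carrier L)"
    and le: "\<And>x y. x \<in> carrier L \<Longrightarrow> y \<in> carrier L \<Longrightarrow> x \<sqsubseteq>\<^bsub>L\<^esub> y \<longleftrightarrow> J x \<subseteq> J y"
  shows "partial_order L"
  by unfold_locales (use assms in \<open>auto simp: inj_on_def\<close>)

text \<open>\<open>join\<close> is defined by choice. Having a least upper bound therefore does not
  identify the chosen element by itself; uniqueness of least elements does.\<close>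

lemma (in partial_order) join_eqI:
  assumes "x \<in> carrier L" "y \<in> carrier L" "z \<in> carrier L" "x \<sqsubseteq> z" "y \<sqsubseteq> z"
    and "\<And>w. w \<in> carrier L \<Longrightarrow> x \<sqsubseteq> w \<Longrightarrow> y \<sqsubseteq> w \<Longrightarrow> z \<sqsubseteq> w"
  shows "least L z (Upper L {x, y})" "x \<squnion> y = z"
proof -
  show l: "least L z (Upper L {x, y})"
    using assms by (auto simp: least_def Upper_def)
  show "x \<squnion> y = z"
    unfolding join_def sup_def by (rule some_equality, rule l, rule least_unique[OF _ l])
qed

lemma (in partial_order) meet_eqI:
  assumes "x \<in> carrier L" "y \<in> carrier L" "z \<in> carrier L" "z \<sqsubseteq> x" "z \<sqsubseteq> y"
    and "\<And>w. w \<in> carrier L \<Longrightarrow> w \<sqsubseteq> x \<Longrightarrow> w \<sqsubseteq> y \<Longrightarrow> w \<sqsubseteq> z"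
  shows "greatest L z (Lower L {x, y})" "x \<sqinter> y = z"
proof -
  show l: "greatest L z (Lower L {x, y})"
    using assms by (auto simp: greatest_def Lower_def)
  show "x \<sqinter> y = z"
    unfolding meet_def inf_def by (rule some_equality, rule l, rule greatest_unique[OF _ l])
qed

text \<open>The union of two sets of the family lies in the family again, so it is their least upper
  bound there; dually for intersections. As \<open>J\<close> preserves and reflects the order, these
  bounds pull back to \<open>L\<close>. It will be applied to orbits, with \<open>J\<close> sending
  an orbit to its ideal.\<close>

lemma lattice_of_sets:
  assumes eq: "eq L = (=)"
    and inj: "inj_on J (carrier L)"
    and le: "\<And>x y. x \<in> carrier L \<Longrightarrow> y \<in> carrier L \<Longrightarrow> x \<sqsubseteq>\<^bsub>L\<^esub> y \<longleftrightarrow> J x \<subseteq> J y"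
    and un: "\<And>x y. x \<in> carrier L \<Longrightarrow> y \<in> carrier L \<Longrightarrow> \<exists>z\<in>carrier L. J z = J x \<union> J y"
    and int: "\<And>x y. x \<in> carrier L \<Longrightarrow> y \<in> carrier L \<Longrightarrow> \<exists>z\<in>carrier L. J z = J x \<inter> J y"
  shows "lattice L"
    and "x \<in> carrier L \<Longrightarrow> y \<in> carrier L \<Longrightarrow> J (x \<squnion>\<^bsub>L\<^esub> y) = J x \<union> J y"
    and "x \<in> carrier L \<Longrightarrow> y \<in> carrier L \<Longrightarrow> J (x \<sqinter>\<^bsub>L\<^esub> y) = J x \<inter> J y"
proof -
  interpret partial_order L
    using eq inj le by (rule partial_orderI_subset)
  have join: "\<exists>z. least L z (Upper L {x, y}) \<and> x \<squnion>\<^bsub>L\<^esub> y = z \<and> J z = J x \<union> J y"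
    if x: "x \<in> carrier L" and y: "y \<in> carrier L" for x y
  proof -
    obtain z where z: "z \<in> carrier L" "J z = J x \<union> J y"
      using un[OF x y] by blast
    then show ?thesis
      using join_eqI[OF x y z(1)] x y by (auto simp: le)
  qed
  have meet: "\<exists>z. greatest L z (Lower L {x, y}) \<and> x \<sqinter>\<^bsub>L\<^esub> y = z \<and> J z = J x \<inter> J y"
    if x: "x \<in> carrier L" and y: "y \<in> carrier L" for x y
  proof -
    obtain z where z: "z \<in> carrier L" "J z = J x \<inter> J y"
      using int[OF x y] by blast
    then show ?thesis
      using meet_eqI[OF x y z(1)] x y by (auto simp: le)
  qed
  show "lattice L"
    by unfold_locales (use join meet in blast)+
  show "x \<in> carrier L \<Longrightarrow> y \<in> carrier L \<Longrightarrow> J (x \<squnion>\<^bsub>L\<^esub> y) = J x \<union> J y"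
    using join by blast
  show "x \<in> carrier L \<Longrightarrow> y \<in> carrier L \<Longrightarrow> J (x \<sqinter>\<^bsub>L\<^esub> y) = J x \<inter> J y"
    using meet by blast
qed

section \<open>Characteristic subgroups and automorphism orbits\<close>

text \<open>\<open>AutoGroup\<close> is the group of bijections of the carrier, cut down to the
  automorphisms; the action is the inclusion of this subgroup.\<close>

lemma (in group) group_action_AutoGroup: "group_action (AutoGroup G) (carrier G) (\<lambda>f. f)"
  using group.canonical_inj_is_hom[OF group_BijGroup subgroup_auto]
  by (simp add: group_action_def AutoGroup_def id_def)

lemma (in group) aut_orbit_eq_image: "aut_orbit G a = (\<lambda>f. f a) ` auto G"
  by (auto simp: aut_orbit_def orbit_def AutoGroup_def)

text \<open>Orbits of a group action are equal or disjoint, and these two share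
  \<open>b\<close>.\<close>

lemma (in group) aut_orbit_eqI:
  assumes "a \<in> carrier G" "b \<in> carrier G" "b \<in> aut_orbit G a"
  shows "aut_orbit G b = aut_orbit G a"
proof -
  interpret group_action "AutoGroup G" "carrier G" "\<lambda>f. f"
    by (rule group_action_AutoGroup)
  have "b \<in> aut_orbit G b"
    unfolding aut_orbit_def using assms(2) by (rule orbit_refl)
  with assms show ?thesis
    using disjoint_union[of "aut_orbit G b" "aut_orbit G a"]
    by (auto simp: orbits_def aut_orbit_def)
qed

lemma (in group) characteristic_subgroup_Int:
  assumes "characteristic_subgroup H G" "characteristic_subgroup K G"
  shows "characteristic_subgroup (H \<inter> K) G"
  using assms unfolding characteristic_subgroup_def
  by (blast intro: subgroups_Inter_pair)

lemma (in comm_group) characteristic_subgroup_set_mult: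
  assumes H: "characteristic_subgroup H G" and K: "characteristic_subgroup K G"
  shows "characteristic_subgroup (H <#> K) G"
  unfolding characteristic_subgroup_def
proof (intro conjI ballI subsetI)
  have sub: "H \<subseteq> carrier G" "K \<subseteq> carrier G" "subgroup H G" "subgroup K G"
    using H K by (auto simp: characteristic_subgroup_def subgroup.subset)
  then show "subgroup (H <#> K) G"
    by (simp add: mult_subgroups)
  fix f x assume f: "f \<in> auto G" and "x \<in> f ` (H <#> K)"
  then obtain h k where hk: "h \<in> H" "k \<in> K" "x = f (h \<otimes> k)"
    by (auto simp: set_mult_def)
  moreover have "f h \<in> H" "f k \<in> K"
    using H K f hk unfolding characteristic_subgroup_def by blast+
  moreover have "f (h \<otimes> k) = f h \<otimes> f k"
    using f hk sub by (simp add: auto_def hom_mult subset_iff)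
  ultimately show "x \<in> H <#> K"
    by (auto simp: set_mult_def)
qed

text \<open>Both operations of the subgroup lattice preserve being characteristic. The product
  contains each factor because the other one contains the unit, and a subgroup containing both
  factors contains the product by closure.\<close>

lemma (in comm_group) characteristic_lattice:
  shows lattice_characteristic: "lattice (characteristic_lattice G)"
    and characteristic_join: "\<lbrakk>characteristic_subgroup H G; characteristic_subgroup K G\<rbrakk>
      \<Longrightarrow> H \<squnion>\<^bsub>characteristic_lattice G\<^esub> K = H <#> K"
    and characteristic_meet: "\<lbrakk>characteristic_subgroup H G; characteristic_subgroup K G\<rbrakk>
      \<Longrightarrow> H \<sqinter>\<^bsub>characteristic_lattice G\<^esub> K = H \<inter> K"
proof -
  let ?C = "characteristic_lattice G"
  have car: "H \<in> carrier ?C \<longleftrightarrow> characteristic_subgroup H G"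
    and le: "H \<sqsubseteq>\<^bsub>?C\<^esub> K \<longleftrightarrow> H \<subseteq> K" for H K
    by (auto simp: characteristic_lattice_def)
  interpret partial_order ?C
    by (rule partial_orderI_subset[of _ "\<lambda>H. H"]) (auto simp: characteristic_lattice_def)
  have upper: "H \<subseteq> H <#> K" "K \<subseteq> H <#> K"
    if "characteristic_subgroup H G" "characteristic_subgroup K G" for H K
  proof -
    have "subgroup H G" "subgroup K G"
      using that by (auto simp: characteristic_subgroup_def)
    then have "\<one> \<in> H" "\<one> \<in> K" "H \<subseteq> carrier G" "K \<subseteq> carrier G"
      by (auto simp: subgroup.one_closed subgroup.subset)
    then show "H \<subseteq> H <#> K" "K \<subseteq> H <#> K"
      by (force simp: set_mult_def)+
  qed
  have least: "H <#> K \<subseteq> M" if "characteristic_subgroup M G" "H \<subseteq> M" "K \<subseteq> M" for H K M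
    using that unfolding set_mult_def characteristic_subgroup_def
    by (blast intro: subgroup.m_closed)
  have join: "least ?C (H <#> K) (Upper ?C {H, K})" "H \<squnion>\<^bsub>?C\<^esub> K = H <#> K"
    if "characteristic_subgroup H G" "characteristic_subgroup K G" for H K
    using join_eqI[of H K "H <#> K"] that upper[OF that] least
    by (simp_all add: car le characteristic_subgroup_set_mult)
  have meet: "greatest ?C (H \<inter> K) (Lower ?C {H, K})" "H \<sqinter>\<^bsub>?C\<^esub> K = H \<inter> K"
    if "characteristic_subgroup H G" "characteristic_subgroup K G" for H K
    using meet_eqI[of H K "H \<inter> K"] that
    by (simp_all add: car le characteristic_subgroup_Int)
  show "lattice ?C"
    by unfold_locales (metis car join(1), metis car meet(1))
  show "characteristic_subgroup H G \<Longrightarrow> characteristic_subgroup K G \<Longrightarrow> H \<squnion>\<^bsub>?C\<^esub> K = H <#> K"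
    "characteristic_subgroup H G \<Longrightarrow> characteristic_subgroup K G \<Longrightarrow> H \<sqinter>\<^bsub>?C\<^esub> K = H \<inter> K"
    by (simp_all only: join(2) meet(2))
qed

section \<open>Coordinates of abelian p-groups\<close>

text \<open>Multiplication by \<open>c\<close> is a well-defined map from integers modulo
  \<open>p ^ k\<close> to integers modulo \<open>p ^ l\<close> when \<open>p ^ l\<close> divides
  \<open>c * p ^ k\<close>. The coefficient is \<open>t / x\<close>, with the unit part of
  \<open>x\<close> inverted modulo \<open>p ^ l\<close>. The two entries of the maximum serve two
  purposes: the first makes the quotient integral, the second makes the map well defined.\<close>

lemma exists_coefficient:
  fixes x t p :: int
  assumes p: "prime p" and x: "x \<noteq> 0" "multiplicity p x \<le> k"
    and t: "p ^ max (multiplicity p x) (l - (k - multiplicity p x)) dvd t"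
  obtains c where "[c * x = t] (mod p ^ l)" "p ^ l dvd c * p ^ k"
proof -
  define v where "v = multiplicity p x"
  obtain w where w: "x = p ^ v * w" "\<not> p dvd w"
    using multiplicity_decompose'[of x p] x p unfolding v_def by (metis not_prime_unit)
  have "coprime w (p ^ l)"
    using p w(2) by (simp add: prime_imp_coprime coprime_commute)
  then obtain w' where w': "[w * w' = 1] (mod p ^ l)"
    using cong_solve_coprime_int by blast
  obtain d where d: "t = p ^ max v (l - (k - v)) * d"
    using t unfolding v_def by (auto elim: dvdE)
  \<comment> \<open>This is \<open>t\<close> divided by \<open>p ^ v\<close>; the coefficient will
    be \<open>?s * w'\<close>.\<close>
  let ?s = "p ^ (max v (l - (k - v)) - v) * d"
  have "t = p ^ v * ?s"
    by (simp add: d flip: power_add mult.assoc)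
  then have "[?s * w' * x = t] (mod p ^ l)"
    using cong_scalar_left[OF w', of t] by (simp add: w ac_simps)
  moreover have "p ^ l dvd p ^ (max v (l - (k - v)) - v) * p ^ k"
    unfolding power_add[symmetric] by (rule le_imp_power_dvd) (use x(2) in \<open>auto simp: v_def\<close>)
  then have "p ^ l dvd ?s * w' * p ^ k"
    by (metis dvd_mult2 mult.assoc mult.commute)
  ultimately show thesis
    using that by blast
qed

lemma carrier_abelian_pgroup:
  assumes "prime p"
  shows "a \<in> carrier (abelian_pgroup p lam) \<longleftrightarrow>
    a \<in> extensional {..<length lam} \<and> (\<forall>i<length lam. 0 \<le> a i \<and> a i < int p ^ (lam ! i))"
  using prime_gt_0_nat[OF assms]
  by (auto simp: abelian_pgroup_def carrier_integer_mod_group PiE_iff)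

lemma mult_abelian_pgroup:
  "x \<otimes>\<^bsub>abelian_pgroup p lam\<^esub> y = (\<lambda>i\<in>{..<length lam}. (x i + y i) mod int p ^ (lam ! i))"
  by (simp add: abelian_pgroup_def)

lemma one_abelian_pgroup: "\<one>\<^bsub>abelian_pgroup p lam\<^esub> = (\<lambda>i\<in>{..<length lam}. 0)"
  by (simp add: abelian_pgroup_def)

lemma comm_group_abelian_pgroup: "comm_group (abelian_pgroup p lam)"
proof (rule group.group_comm_groupI)
  show "group (abelian_pgroup p lam)"
    by (simp add: abelian_pgroup_def)
qed (simp add: mult_abelian_pgroup add.commute)

lemma inv_abelian_pgroup:
  assumes "x \<in> carrier (abelian_pgroup p lam)"
  shows "inv\<^bsub>abelian_pgroup p lam\<^esub> x = (\<lambda>i\<in>{..<length lam}. - x i mod int p ^ (lam ! i))"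
  using assms unfolding abelian_pgroup_def
  by (subst inv_product_group) (auto intro!: restrict_ext simp: PiE_iff)

lemma finite_abelian_pgroup: "prime p \<Longrightarrow> finite (carrier (abelian_pgroup p lam))"
  using prime_gt_0_nat[of p]
  by (auto simp: abelian_pgroup_def carrier_integer_mod_group intro!: finite_PiE)

lemma nat_pow_abelian_pgroup:
  "x [^]\<^bsub>abelian_pgroup p lam\<^esub> (m :: nat)
     = (\<lambda>i\<in>{..<length lam}. (int m * x i) mod int p ^ (lam ! i))"
proof (induction m)
  case 0
  show ?case
    by (simp add: nat_pow_def one_abelian_pgroup)
next
  case (Suc m)
  then show ?case
    by (auto simp: nat_pow_def mult_abelian_pgroup algebra_simps mod_simps intro!: restrict_ext)
qed

section \<open>Ideals of elements via divisibility, and their behaviour under homomorphisms\<close>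

lemma mem_elt_ideal:
  "(r, k) \<in> elt_ideal p lam a \<longleftrightarrow> r < k \<and> (\<exists>i<length lam. a i \<noteq> 0 \<and>
     multiplicity (int p) (a i) \<le> r \<and> k - r \<le> lam ! i - multiplicity (int p) (a i))"
  by (fastforce simp: elt_ideal_def generated_order_ideal_def fund_poset_def)

text \<open>A non-zero representative below \<open>p ^ (lam ! i)\<close> is not divisible by that
  power. So the pair formed from such a coordinate really is a symbol of the fundamental
  poset.\<close>

lemma multiplicity_less_exponent:
  assumes p: "prime p" and a: "a \<in> carrier (abelian_pgroup p lam)"
    and i: "i < length lam" "a i \<noteq> 0"
  shows "multiplicity (int p) (a i) < lam ! i"
proof (rule ccontr)
  assume "\<not> ?thesis"
  then have "int p ^ (lam ! i) dvd a i"
    by (meson multiplicity_dvd' not_less)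
  then have "int p ^ (lam ! i) \<le> a i"
    using a i p by (intro zdvd_imp_le) (auto simp: carrier_abelian_pgroup le_less)
  then show False
    using a i p by (auto simp: carrier_abelian_pgroup)
qed

text \<open>A coordinate of multiplicity \<open>v\<close> fails to dominate the symbol iff
  \<open>v > r\<close> or \<open>v \<ge> lam ! i - (k - Suc r)\<close>; the minimum merges the two
  alternatives. Divisibility also covers zero coordinates and survives sums and negation.\<close>

lemma not_mem_elt_ideal:
  assumes p: "prime p" and "r < k"
  shows "(r, k) \<notin> elt_ideal p lam a \<longleftrightarrow>
    (\<forall>i<length lam. int p ^ min (Suc r) (lam ! i - (k - Suc r)) dvd a i)"
proof -
  have "int p ^ min (Suc r) (lam ! i - (k - Suc r)) dvd a i \<longleftrightarrow>
      \<not> (a i \<noteq> 0 \<and> multiplicity (int p) (a i) \<le> r \<and> k - r \<le> lam ! i - multiplicity (int p) (a i))"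
    for i
  proof (cases "a i = 0")
    case False
    moreover have "\<not> is_unit (int p)"
      using p by (simp add: prime_nat_iff)
    ultimately have "int p ^ min (Suc r) (lam ! i - (k - Suc r)) dvd a i \<longleftrightarrow>
        min (Suc r) (lam ! i - (k - Suc r)) \<le> multiplicity (int p) (a i)"
      by (simp add: power_dvd_iff_le_multiplicity)
    then show ?thesis
      using False \<open>r < k\<close> by auto
  qed simp
  then show ?thesis
    using \<open>r < k\<close> by (auto simp: mem_elt_ideal)
qed

text \<open>Being free of coordinates, this description shows that homomorphisms can only shrink the ideal.\<close>

lemma not_mem_elt_ideal_iff_decomposition:
  assumes p: "prime p" and a: "a \<in> carrier (abelian_pgroup p lam)" and "r < k"
  shows "(r, k) \<notin> elt_ideal p lam a \<longleftrightarrow>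
    (\<exists>x\<in>carrier (abelian_pgroup p lam). \<exists>y\<in>carrier (abelian_pgroup p lam).
       y [^]\<^bsub>abelian_pgroup p lam\<^esub> (p ^ (k - Suc r)) = \<one>\<^bsub>abelian_pgroup p lam\<^esub> \<and>
       a = x [^]\<^bsub>abelian_pgroup p lam\<^esub> (p ^ Suc r) \<otimes>\<^bsub>abelian_pgroup p lam\<^esub> y)"
    (is "?lhs \<longleftrightarrow> ?rhs")
proof
  let ?A = "abelian_pgroup p lam"
  let ?e = "\<lambda>i. min (Suc r) (lam ! i - (k - Suc r))"
  let ?m = "k - Suc r"
  have p0: "int p > 0"
    using p by (simp add: prime_gt_0_nat)
  note car = carrier_abelian_pgroup[OF p]
  {
    assume ?lhs
    then have dvd: "int p ^ ?e i dvd a i" if "i < length lam" for i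
      using that p \<open>r < k\<close> by (simp add: not_mem_elt_ideal)
    \<comment> \<open>Each coordinate goes entirely to one side. One that is not divisible by
      \<open>p ^ Suc r\<close> goes to \<open>y\<close>; for it the minimum in \<open>?e\<close>
      must be the other entry, which is what makes \<open>p ^ ?m\<close> annihilate it.\<close>
    define x where "x = (\<lambda>i\<in>{..<length lam}.
      if int p ^ Suc r dvd a i then a i div int p ^ Suc r else 0)"
    define y where "y = (\<lambda>i\<in>{..<length lam}. if int p ^ Suc r dvd a i then 0 else a i)"
    have "a i div int p ^ Suc r \<le> a i" if "i < length lam" for i
      using zdiv_mono2[of "a i" 1 "int p ^ Suc r"] a that p0
      by (simp add: car one_le_power del: power_Suc)
    then have x: "x \<in> carrier ?A"
      using a p0 by (auto simp: car x_def pos_imp_zdiv_nonneg_iff intro: le_less_trans)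
    moreover have y: "y \<in> carrier ?A"
      using a p0 by (auto simp: car y_def)
    moreover have "a = x [^]\<^bsub>?A\<^esub> (p ^ Suc r) \<otimes>\<^bsub>?A\<^esub> y"
      using a by (intro extensionalityI[of _ "{..<length lam}"])
        (auto simp: car nat_pow_abelian_pgroup mult_abelian_pgroup x_def y_def simp del: power_Suc)
    moreover have "int p ^ (lam ! i) dvd int p ^ ?m * a i"
      if "i < length lam" "\<not> int p ^ Suc r dvd a i" for i
    proof -
      have "int p ^ (lam ! i - ?m) dvd a i"
        using dvd[OF that(1)] that(2) by (auto simp: min_def split: if_splits)
      then have "int p ^ (?m + (lam ! i - ?m)) dvd int p ^ ?m * a i"
        by (simp add: power_add)
      then show ?thesis
        by (rule dvd_trans[rotated]) (simp add: le_imp_power_dvd)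
    qed
    then have "y [^]\<^bsub>?A\<^esub> (p ^ ?m) = \<one>\<^bsub>?A\<^esub>"
      by (auto simp: nat_pow_abelian_pgroup one_abelian_pgroup y_def intro!: restrict_ext)
    ultimately show ?rhs
      by blast
  }
  assume ?rhs
  then obtain x y where xy: "y [^]\<^bsub>?A\<^esub> (p ^ ?m) = \<one>\<^bsub>?A\<^esub>" "a = x [^]\<^bsub>?A\<^esub> (p ^ Suc r) \<otimes>\<^bsub>?A\<^esub> y"
    by blast
  have "int p ^ ?e i dvd a i" if i: "i < length lam" for i
  proof -
    have "int p ^ (lam ! i) dvd int p ^ ?m * y i"
      using fun_cong[OF xy(1), of i] i
      by (simp add: nat_pow_abelian_pgroup one_abelian_pgroup mod_eq_0_iff_dvd)
    \<comment> \<open>The subtraction is truncated: if \<open>lam ! i \<le> ?m\<close>, the exponent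
      \<open>lam ! i - ?m\<close> is 0 and the divisibility sought is trivial.\<close>
    moreover have "int p ^ (?m + (lam ! i - ?m)) dvd int p ^ (lam ! i) \<or> lam ! i \<le> ?m"
      by auto
    ultimately have "int p ^ ?m * int p ^ (lam ! i - ?m) dvd int p ^ ?m * y i \<or> lam ! i \<le> ?m"
      by (metis dvd_trans power_add)
    then have "int p ^ (lam ! i - ?m) dvd y i"
      using p0 by auto
    then have "int p ^ ?e i dvd y i"
      by (rule dvd_trans[rotated]) (simp add: le_imp_power_dvd)
    moreover have "int p ^ ?e i dvd int p ^ Suc r * x i"
      by (intro dvd_mult2 le_imp_power_dvd) simp
    moreover have "int p ^ ?e i dvd int p ^ (lam ! i)"
      by (intro le_imp_power_dvd) simp
    ultimately show ?thesis
      using i by (simp add: xy(2) nat_pow_abelian_pgroup mult_abelian_pgroup dvd_mod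
        del: power_Suc)
  qed
  then show ?lhs
    using p \<open>r < k\<close> by (simp add: not_mem_elt_ideal)
qed

text \<open>A homomorphism carries a decomposition of \<open>a\<close> to one of \<open>h a\<close>
  with the same exponents, so a symbol missing from the ideal of \<open>a\<close> is missing from
  that of \<open>h a\<close>.\<close>

lemma elt_ideal_hom_subset:
  assumes p: "prime p" and a: "a \<in> carrier (abelian_pgroup p lam)"
    and h: "h \<in> hom (abelian_pgroup p lam) (abelian_pgroup p lam)"
  shows "elt_ideal p lam (h a) \<subseteq> elt_ideal p lam a"
proof (intro subrelI)
  fix r k assume rk: "(r, k) \<in> elt_ideal p lam (h a)"
  then have "r < k"
    by (simp add: mem_elt_ideal)
  let ?A = "abelian_pgroup p lam"
  interpret comm_group ?A
    by (rule comm_group_abelian_pgroup)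
  interpret group_hom ?A ?A h
    by unfold_locales (rule h)
  show "(r, k) \<in> elt_ideal p lam a"
  proof (rule ccontr)
    assume "(r, k) \<notin> elt_ideal p lam a"
    then obtain x y where xy: "x \<in> carrier ?A" "y \<in> carrier ?A"
      "y [^]\<^bsub>?A\<^esub> (p ^ (k - Suc r)) = \<one>\<^bsub>?A\<^esub>" "a = x [^]\<^bsub>?A\<^esub> (p ^ Suc r) \<otimes>\<^bsub>?A\<^esub> y"
      using not_mem_elt_ideal_iff_decomposition[OF p a \<open>r < k\<close>] by blast
    then have "h y [^]\<^bsub>?A\<^esub> (p ^ (k - Suc r)) = \<one>\<^bsub>?A\<^esub>"
      "h a = h x [^]\<^bsub>?A\<^esub> (p ^ Suc r) \<otimes>\<^bsub>?A\<^esub> h y"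
      by (simp_all flip: hom_nat_pow)
    then have "(r, k) \<notin> elt_ideal p lam (h a)"
      using not_mem_elt_ideal_iff_decomposition[OF p _ \<open>r < k\<close>] xy a by (metis hom_closed)
    with rk show False
      by blast
  qed
qed

section \<open>Order ideals of elements\<close>

text \<open>These are the ideals of P_\<lambda>, with the order of \<open>fund_poset\<close>
  unfolded.\<close>

definition part_order_ideal :: "nat list \<Rightarrow> (nat \<times> nat) set \<Rightarrow> bool" where
  "part_order_ideal lam I \<longleftrightarrow> (\<forall>r k. (r, k) \<in> I \<longrightarrow> r < k \<and> k \<in> set lam) \<and>
     (\<forall>r k s l. (r, k) \<in> I \<longrightarrow> s < l \<longrightarrow> l \<in> set lam \<longrightarrow> r \<le> s \<longrightarrow> l - s \<le> k - r \<longrightarrow> (s, l) \<in> I)"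

lemma part_order_idealD:
  assumes "part_order_ideal lam I" "(r, k) \<in> I"
  shows "r < k" "k \<in> set lam"
  using assms unfolding part_order_ideal_def by blast+

lemma part_order_ideal_Un: "part_order_ideal lam I \<Longrightarrow> part_order_ideal lam J \<Longrightarrow> part_order_ideal lam (I \<union> J)"
  unfolding part_order_ideal_def by blast

lemma part_order_ideal_Int: "part_order_ideal lam I \<Longrightarrow> part_order_ideal lam J \<Longrightarrow> part_order_ideal lam (I \<inter> J)"
  unfolding part_order_ideal_def by blast

lemma mem_elt_ideal_part:
  "(r, k) \<in> elt_ideal_part p lam a \<longleftrightarrow> k \<in> set lam \<and> (r, k) \<in> elt_ideal p lam a"
  by (auto simp: elt_ideal_part_def fund_poset_part_def fund_poset_def mem_elt_ideal)

lemma part_order_ideal_elt_ideal_part: "part_order_ideal lam (elt_ideal_part p lam a)"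
  unfolding part_order_ideal_def mem_elt_ideal_part mem_elt_ideal
  by (blast intro: order_trans)

lemma coordinate_mem_elt_ideal_part:
  assumes "prime p" "a \<in> carrier (abelian_pgroup p lam)" "i < length lam" "a i \<noteq> 0"
  shows "(multiplicity (int p) (a i), lam ! i) \<in> elt_ideal_part p lam a"
  using multiplicity_less_exponent[OF assms] assms(3,4)
  by (auto simp: mem_elt_ideal_part mem_elt_ideal)

text \<open>An ideal contains a generated ideal as soon as it contains the generators. This turns
  membership in \<open>ideal_subgroup\<close> into a test on single coordinates.\<close>

lemma elt_ideal_part_subset_iff:
  assumes p: "prime p" and a: "a \<in> carrier (abelian_pgroup p lam)" and I: "part_order_ideal lam I"
  shows "elt_ideal_part p lam a \<subseteq> I \<longleftrightarrow>
    (\<forall>i<length lam. a i \<noteq> 0 \<longrightarrow> (multiplicity (int p) (a i), lam ! i) \<in> I)"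
proof
  show "elt_ideal_part p lam a \<subseteq> I \<Longrightarrow>
    (\<forall>i<length lam. a i \<noteq> 0 \<longrightarrow> (multiplicity (int p) (a i), lam ! i) \<in> I)"
    using coordinate_mem_elt_ideal_part[OF p a] by blast
  show "\<forall>i<length lam. a i \<noteq> 0 \<longrightarrow> (multiplicity (int p) (a i), lam ! i) \<in> I \<Longrightarrow>
    elt_ideal_part p lam a \<subseteq> I"
    using I unfolding part_order_ideal_def
    by (auto simp: mem_elt_ideal_part mem_elt_ideal) blast
qed

text \<open>The divisibilities in \<open>not_mem_elt_ideal\<close> pass to sums; they survive
  reduction modulo \<open>p ^ (lam ! i)\<close> because their exponents are at most
  \<open>lam ! i\<close>.\<close>

lemma elt_ideal_mult_subset:
  assumes p: "prime p"
  shows "elt_ideal p lam (x \<otimes>\<^bsub>abelian_pgroup p lam\<^esub> y) \<subseteq> elt_ideal p lam x \<union> elt_ideal p lam y"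
proof (intro subrelI)
  fix r k assume *: "(r, k) \<in> elt_ideal p lam (x \<otimes>\<^bsub>abelian_pgroup p lam\<^esub> y)"
  then have "r < k"
    by (simp add: mem_elt_ideal)
  show "(r, k) \<in> elt_ideal p lam x \<union> elt_ideal p lam y"
  proof (rule ccontr)
    assume "\<not> ?thesis"
    then have "(r, k) \<notin> elt_ideal p lam (x \<otimes>\<^bsub>abelian_pgroup p lam\<^esub> y)"
      by (simp add: not_mem_elt_ideal[OF p \<open>r < k\<close>] mult_abelian_pgroup dvd_mod le_imp_power_dvd)
    with * show False
      by blast
  qed
qed

lemma elt_ideal_inv_subset:
  assumes p: "prime p" and x: "x \<in> carrier (abelian_pgroup p lam)"
  shows "elt_ideal p lam (inv\<^bsub>abelian_pgroup p lam\<^esub> x) \<subseteq> elt_ideal p lam x"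
proof (intro subrelI)
  fix r k assume *: "(r, k) \<in> elt_ideal p lam (inv\<^bsub>abelian_pgroup p lam\<^esub> x)"
  then have "r < k"
    by (simp add: mem_elt_ideal)
  show "(r, k) \<in> elt_ideal p lam x"
  proof (rule ccontr)
    assume "\<not> ?thesis"
    then have "(r, k) \<notin> elt_ideal p lam (inv\<^bsub>abelian_pgroup p lam\<^esub> x)"
      by (simp add: not_mem_elt_ideal[OF p \<open>r < k\<close>] inv_abelian_pgroup[OF x] dvd_mod le_imp_power_dvd)
    with * show False
      by blast
  qed
qed

section \<open>The subgroups attached to ideals\<close>

lemma characteristic_subgroup_ideal_subgroup:
  assumes p: "prime p"
  shows "characteristic_subgroup (ideal_subgroup p lam I) (abelian_pgroup p lam)"
proof -
  let ?A = "abelian_pgroup p lam"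
  interpret comm_group ?A
    by (rule comm_group_abelian_pgroup)
  show ?thesis
    unfolding characteristic_subgroup_def
  proof (intro conjI ballI subsetI)
    show "subgroup (ideal_subgroup p lam I) ?A"
    proof (rule subgroup.intro)
      show "\<one>\<^bsub>?A\<^esub> \<in> ideal_subgroup p lam I"
        by (auto simp: ideal_subgroup_def mem_elt_ideal_part mem_elt_ideal)
          (auto simp: one_abelian_pgroup)
      show "x \<otimes>\<^bsub>?A\<^esub> y \<in> ideal_subgroup p lam I"
        if "x \<in> ideal_subgroup p lam I" "y \<in> ideal_subgroup p lam I" for x y
        using that elt_ideal_mult_subset[OF p, of lam x y]
        by (auto simp only: ideal_subgroup_def elt_ideal_part_def intro: m_closed)
      show "inv\<^bsub>?A\<^esub> x \<in> ideal_subgroup p lam I" if "x \<in> ideal_subgroup p lam I" for x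
        using that elt_ideal_inv_subset[OF p, of x lam]
        by (auto simp only: ideal_subgroup_def elt_ideal_part_def intro: inv_closed)
    qed (auto simp: ideal_subgroup_def)
    fix f b assume f: "f \<in> auto ?A" and "b \<in> f ` ideal_subgroup p lam I"
    then obtain a where a: "a \<in> carrier ?A" "elt_ideal_part p lam a \<subseteq> I" "b = f a"
      by (auto simp: ideal_subgroup_def)
    have h: "f \<in> hom ?A ?A"
      using f by (simp add: auto_def)
    then have "elt_ideal_part p lam b \<subseteq> elt_ideal_part p lam a"
      using elt_ideal_hom_subset[OF p a(1)] a(3) by (auto simp: elt_ideal_part_def)
    then show "b \<in> ideal_subgroup p lam I"
      using a hom_in_carrier[OF h] by (auto simp: ideal_subgroup_def)
  qed
qed

lemma ideal_subgroup_Int: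
  "ideal_subgroup p lam (I \<inter> J) = ideal_subgroup p lam I \<inter> ideal_subgroup p lam J"
  by (auto simp: ideal_subgroup_def)

lemma ideal_subgroup_Un:
  assumes p: "prime p" and I: "part_order_ideal lam I" and J: "part_order_ideal lam J"
  shows "ideal_subgroup p lam (I \<union> J) =
    ideal_subgroup p lam I <#>\<^bsub>abelian_pgroup p lam\<^esub> ideal_subgroup p lam J"
proof
  let ?A = "abelian_pgroup p lam"
  note car = carrier_abelian_pgroup[OF p]
  have p0: "int p > 0"
    using p by (simp add: prime_gt_0_nat)
  show "ideal_subgroup p lam (I \<union> J) \<subseteq> ideal_subgroup p lam I <#>\<^bsub>?A\<^esub> ideal_subgroup p lam J"
  proof
    fix a assume "a \<in> ideal_subgroup p lam (I \<union> J)"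
    then have a: "a \<in> carrier ?A" "elt_ideal_part p lam a \<subseteq> I \<union> J"
      by (auto simp: ideal_subgroup_def)
    \<comment> \<open>Coordinates with symbol in \<open>I\<close> go to \<open>x\<close>, the
      others, whose symbols must lie in \<open>J\<close>, to \<open>y\<close>. If
      \<open>a i = 0\<close>, the pair tested means nothing, but both sides receive 0.\<close>
    let ?in = "\<lambda>i. (multiplicity (int p) (a i), lam ! i) \<in> I"
    define x where "x = (\<lambda>i\<in>{..<length lam}. if ?in i then a i else 0)"
    define y where "y = (\<lambda>i\<in>{..<length lam}. if ?in i then 0 else a i)"
    have xy: "x \<in> carrier ?A" "y \<in> carrier ?A"
      using a(1) p0 by (auto simp: car x_def y_def)
    moreover have "elt_ideal_part p lam x \<subseteq> I"
      by (subst elt_ideal_part_subset_iff[OF p xy(1) I]) (simp add: x_def)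
    moreover have "\<forall>i<length lam. a i \<noteq> 0 \<longrightarrow> (multiplicity (int p) (a i), lam ! i) \<in> I \<union> J"
      using a elt_ideal_part_subset_iff[OF p a(1) part_order_ideal_Un[OF I J]] by blast
    then have "elt_ideal_part p lam y \<subseteq> J"
      by (subst elt_ideal_part_subset_iff[OF p xy(2) J]) (auto simp: y_def)
    moreover have "a = x \<otimes>\<^bsub>?A\<^esub> y"
      using a(1) by (intro extensionalityI[of _ "{..<length lam}"])
        (auto simp: car mult_abelian_pgroup x_def y_def)
    ultimately show "a \<in> ideal_subgroup p lam I <#>\<^bsub>?A\<^esub> ideal_subgroup p lam J"
      by (auto simp: set_mult_def ideal_subgroup_def)
  qed
  interpret comm_group ?A
    by (rule comm_group_abelian_pgroup)
  show "ideal_subgroup p lam I <#>\<^bsub>?A\<^esub> ideal_subgroup p lam J \<subseteq> ideal_subgroup p lam (I \<union> J)"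
    using elt_ideal_mult_subset[OF p]
    by (fastforce simp: set_mult_def ideal_subgroup_def elt_ideal_part_def)
qed

section \<open>Canonical elements realizing every ideal\<close>

definition ideal_element :: "nat \<Rightarrow> nat list \<Rightarrow> (nat \<times> nat) set \<Rightarrow> nat \<Rightarrow> int" where
  "ideal_element p lam I = (\<lambda>i\<in>{..<length lam}.
     if \<exists>r. (r, lam ! i) \<in> I then int p ^ (LEAST r. (r, lam ! i) \<in> I) else 0)"

text \<open>The symbols with a fixed part form a chain in which smaller exponents are higher. The
  least exponent thus gives the top symbol of \<open>I\<close> in that chain, and these top symbols
  generate \<open>I\<close>. Being below the part, the exponent yields a valid non-zero
  representative.\<close>

lemma ideal_element:
  assumes p: "prime p" and I: "part_order_ideal lam I"
  shows ideal_element_carrier: "ideal_element p lam I \<in> carrier (abelian_pgroup p lam)"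
    and elt_ideal_part_ideal_element: "elt_ideal_part p lam (ideal_element p lam I) = I"
proof -
  let ?c = "ideal_element p lam I"
  let ?r = "\<lambda>k. LEAST r. (r, k) \<in> I"
  have p1: "int p > 1"
    using prime_gt_1_nat[OF p] by simp
  have least: "(?r k, k) \<in> I" if "(r, k) \<in> I" for r k
    using that by (rule LeastI)
  have less: "?r k < k" if "(r, k) \<in> I" for r k
    using least[OF that] part_order_idealD[OF I] by blast
  show c: "?c \<in> carrier (abelian_pgroup p lam)"
    using p1 less by (auto simp: carrier_abelian_pgroup[OF p] ideal_element_def)
  have mult: "multiplicity (int p) (int p ^ r) = r" for r
    using p1 by (intro multiplicity_same_power) auto
  show "elt_ideal_part p lam ?c = I"
  proof
    have "(multiplicity (int p) (?c i), lam ! i) \<in> I" if "i < length lam" "?c i \<noteq> 0" for i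
    proof (cases "\<exists>r. (r, lam ! i) \<in> I")
      case True
      then have "?c i = int p ^ ?r (lam ! i)"
        using that(1) by (simp add: ideal_element_def)
      then show ?thesis
        using True least mult by metis
    next
      case False
      with that show ?thesis
        by (simp add: ideal_element_def)
    qed
    then show "elt_ideal_part p lam ?c \<subseteq> I"
      using elt_ideal_part_subset_iff[OF p c I] by blast
    show "I \<subseteq> elt_ideal_part p lam ?c"
    proof (intro subrelI)
      fix r k assume rk: "(r, k) \<in> I"
      then have "r < k" and k: "k \<in> set lam"
        using part_order_idealD[OF I] by blast+
      then obtain i where i: "i < length lam" "k = lam ! i"
        by (auto simp: in_set_conv_nth)
      have "?c i = int p ^ ?r k"
        using i rk by (auto simp: ideal_element_def)
      moreover have "?r k \<le> r"
        using rk by (rule Least_le)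
      ultimately have "?c i \<noteq> 0" "multiplicity (int p) (?c i) \<le> r"
        "k - r \<le> lam ! i - multiplicity (int p) (?c i)"
        using p1 i by (simp_all add: mult)
      then show "(r, k) \<in> elt_ideal_part p lam ?c"
        unfolding mem_elt_ideal_part mem_elt_ideal using \<open>r < k\<close> k i(1) by blast
    qed
  qed
qed

section \<open>Homomorphisms and automorphisms moving an element\<close>

text \<open>The divisibility of \<open>c j\<close> makes multiplication by it well defined from
  factor \<open>s j\<close> to factor \<open>j\<close>. One extra source per coordinate suffices for
  both uses: \<open>u = 0\<close> gives the homomorphisms between given elements, unit or trivial
  \<open>u\<close> the triangular automorphisms.\<close>

lemma coordinate_hom:
  assumes p: "prime p"
    and s: "\<And>j. j < length lam \<Longrightarrow> s j < length lam"
    and c: "\<And>j. j < length lam \<Longrightarrow> int p ^ (lam ! j) dvd c j * int p ^ (lam ! s j)"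
  shows "(\<lambda>x. \<lambda>j\<in>{..<length lam}. (u j * x j + c j * x (s j)) mod int p ^ (lam ! j))
    \<in> hom (abelian_pgroup p lam) (abelian_pgroup p lam)"
proof (rule homI)
  let ?A = "abelian_pgroup p lam"
  let ?h = "\<lambda>x. \<lambda>j\<in>{..<length lam}. (u j * x j + c j * x (s j)) mod int p ^ (lam ! j)"
  show "?h x \<in> carrier ?A" for x
    using p by (auto simp: carrier_abelian_pgroup[OF p] prime_gt_0_nat)
  fix x y
  have "(u j * ((x j + y j) mod int p ^ (lam ! j)) +
      c j * ((x (s j) + y (s j)) mod int p ^ (lam ! s j))) mod int p ^ (lam ! j) =
    (u j * x j + c j * x (s j) + (u j * y j + c j * y (s j))) mod int p ^ (lam ! j)"
    if j: "j < length lam" for j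
  proof -
    let ?z = "x (s j) + y (s j)"
    let ?q = "int p ^ (lam ! s j)"
    \<comment> \<open>Reducing \<open>?z\<close> modulo \<open>?q\<close> changes
      \<open>c j * ?z\<close> by a multiple of \<open>c j * ?q\<close>.\<close>
    have "int p ^ (lam ! j) dvd c j * ?q * (?z div ?q)"
      using c[OF j] by (rule dvd_mult2)
    also have "c j * ?q * (?z div ?q) = c j * ?z - c j * (?z mod ?q)"
      by (metis minus_mod_eq_mult_div mult.assoc right_diff_distrib)
    finally have "[c j * (?z mod ?q) = c j * ?z] (mod int p ^ (lam ! j))"
      by (simp add: cong_iff_dvd_diff dvd_diff_commute)
    moreover have "[u j * ((x j + y j) mod int p ^ (lam ! j)) = u j * (x j + y j)]
        (mod int p ^ (lam ! j))"
      by (simp add: cong_def mod_simps)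
    ultimately show ?thesis
      unfolding cong_def[symmetric] by (auto dest: cong_add simp: algebra_simps)
  qed
  then show "?h (x \<otimes>\<^bsub>?A\<^esub> y) = ?h x \<otimes>\<^bsub>?A\<^esub> ?h y"
    by (auto simp: mult_abelian_pgroup s mod_simps intro!: restrict_ext)
qed

text \<open>This realizes the order of the fundamental poset by maps of cyclic groups: if the symbol
  of \<open>a i\<close> dominates \<open>(r, l)\<close>, both exponents required by
  \<open>exists_coefficient\<close> are at most \<open>r\<close>.\<close>

lemma exists_coordinate_coefficient:
  assumes p: "prime p" and a: "a \<in> carrier (abelian_pgroup p lam)"
    and i: "i < length lam" "a i \<noteq> 0"
    and r: "multiplicity (int p) (a i) \<le> r" "l - r \<le> lam ! i - multiplicity (int p) (a i)"
    and t: "int p ^ r dvd t"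
  obtains c where "[c * a i = t] (mod int p ^ l)" "int p ^ l dvd c * int p ^ (lam ! i)"
proof -
  let ?v = "multiplicity (int p) (a i)"
  have "int p ^ max ?v (l - (lam ! i - ?v)) dvd t"
    by (rule dvd_trans[OF le_imp_power_dvd t]) (use r in auto)
  then show thesis
    using exists_coefficient[of "int p" "a i" "lam ! i" l t thesis] that i p
      multiplicity_less_exponent[OF p a i] by simp
qed

lemma abelian_pgroup_eqI:
  assumes p: "prime p" and "b \<in> carrier (abelian_pgroup p lam)"
    and "\<And>j. j < length lam \<Longrightarrow> [f j = b j] (mod int p ^ (lam ! j))"
  shows "(\<lambda>j\<in>{..<length lam}. f j mod int p ^ (lam ! j)) = b"
  using assms by (intro extensionalityI[of _ "{..<length lam}"])
    (auto simp: carrier_abelian_pgroup[OF p] cong_def)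

text \<open>The symbol of each non-zero \<open>b j\<close> lies below that of some
  \<open>a i\<close>, so a multiple of this single coordinate already produces
  \<open>b j\<close>.\<close>

lemma exists_hom_of_elt_ideal_part_subset:
  assumes p: "prime p" and a: "a \<in> carrier (abelian_pgroup p lam)"
    and b: "b \<in> carrier (abelian_pgroup p lam)"
    and sub: "elt_ideal_part p lam b \<subseteq> elt_ideal_part p lam a"
  shows "\<exists>h\<in>hom (abelian_pgroup p lam) (abelian_pgroup p lam). h a = b"
proof -
  have "\<exists>s c. s < length lam \<and> int p ^ (lam ! j) dvd c * int p ^ (lam ! s) \<and>
      [c * a s = b j] (mod int p ^ (lam ! j))" if j: "j < length lam" for j
  proof (cases "b j = 0")
    case True
    with j show ?thesis
      by (intro exI[of _ j] exI[of _ 0]) auto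
  next
    case False
    let ?r = "multiplicity (int p) (b j)"
    have "(?r, lam ! j) \<in> elt_ideal_part p lam a"
      using coordinate_mem_elt_ideal_part[OF p b j False] sub by blast
    then obtain i where i: "i < length lam" "a i \<noteq> 0" "multiplicity (int p) (a i) \<le> ?r"
      "lam ! j - ?r \<le> lam ! i - multiplicity (int p) (a i)"
      by (auto simp: mem_elt_ideal_part mem_elt_ideal)
    then show ?thesis
      by (metis exists_coordinate_coefficient[OF p a i] multiplicity_dvd)
  qed
  then obtain s c where sc: "\<And>j. j < length lam \<Longrightarrow> s j < length lam"
    "\<And>j. j < length lam \<Longrightarrow> int p ^ (lam ! j) dvd c j * int p ^ (lam ! s j)"
    "\<And>j. j < length lam \<Longrightarrow> [c j * a (s j) = b j] (mod int p ^ (lam ! j))"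
    by metis
  show ?thesis
    by (rule bexI[OF _ coordinate_hom[OF p sc(1,2), where u = "\<lambda>_. 0"]])
      (use abelian_pgroup_eqI[OF p b sc(3)] in simp_all)
qed

text \<open>Coordinates generating a maximal element of the ideal are rescaled by units; a multiple of
  one of them is added to every other coordinate. This is triangular, hence bijective.\<close>

lemma exists_automorphism_to_ideal_element:
  assumes p: "prime p" and a: "a \<in> carrier (abelian_pgroup p lam)"
  shows "\<exists>f\<in>auto (abelian_pgroup p lam). f a = ideal_element p lam (elt_ideal_part p lam a)"
proof -
  let ?A = "abelian_pgroup p lam"
  let ?I = "elt_ideal_part p lam a"
  let ?v = "\<lambda>i. multiplicity (int p) (a i)"
  define e where "e = ideal_element p lam ?I"
  have p1: "int p > 1"
    using prime_gt_1_nat[OF p] by simp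
  have e: "e \<in> carrier ?A"
    unfolding e_def by (intro ideal_element_carrier p part_order_ideal_elt_ideal_part)
  \<comment> \<open>Indices whose symbols are maximal among those of the non-zero coordinates.
    Requiring equality of symbols rather than of indices keeps all repetitions of a maximal symbol
    in \<open>M\<close>.\<close>
  define M where "M = {j. j < length lam \<and> a j \<noteq> 0 \<and> (\<forall>i<length lam. a i \<noteq> 0 \<longrightarrow> ?v i \<le> ?v j \<longrightarrow>
    lam ! j - ?v j \<le> lam ! i - ?v i \<longrightarrow> ?v i = ?v j \<and> lam ! i = lam ! j)}"
  have v_less: "?v i < lam ! i" if "i < length lam" "a i \<noteq> 0" for i
    using multiplicity_less_exponent[OF p a that] .
  have below_M: "\<exists>i\<in>M. ?v i \<le> r \<and> k - r \<le> lam ! i - ?v i" if rk: "(r, k) \<in> ?I" for r k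
  proof -
    define S where "S = {i. i < length lam \<and> a i \<noteq> 0 \<and> ?v i \<le> r \<and> k - r \<le> lam ! i - ?v i}"
    \<comment> \<open>This is \<open>(lam ! i - ?v i) - ?v i\<close>, strictly increasing along the
      order of symbols, so a maximizer over \<open>S\<close> has a maximal symbol. Integers are used
      because the value may be negative.\<close>
    let ?f = "\<lambda>i. int (lam ! i) - 2 * int (?v i)"
    have "finite S" "S \<noteq> {}"
      using rk by (auto simp: S_def mem_elt_ideal_part mem_elt_ideal)
    then obtain i where i: "i \<in> S" "?f i = Max (?f ` S)"
      by (metis (no_types, lifting) Max_in finite_imageI imageE image_is_empty)
    then have max: "?f j \<le> ?f i" if "j \<in> S" for j
      using that \<open>finite S\<close> by simp
    have "?v j = ?v i \<and> lam ! j = lam ! i"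
      if j: "j < length lam" "a j \<noteq> 0" "?v j \<le> ?v i" "lam ! i - ?v i \<le> lam ! j - ?v j" for j
    proof -
      have "j \<in> S"
        using i(1) j by (auto simp: S_def)
      then show ?thesis
        using max[of j] j v_less[of j] v_less[of i] i(1) by (auto simp: S_def)
    qed
    then show ?thesis
      using i(1) by (auto simp: S_def M_def)
  qed
  have e_M: "e j = int p ^ ?v j" if "j \<in> M" for j
  proof -
    have j: "j < length lam" "a j \<noteq> 0"
      using that by (auto simp: M_def)
    have mem: "(?v j, lam ! j) \<in> ?I"
      by (rule coordinate_mem_elt_ideal_part[OF p a j])
    \<comment> \<open>A smaller exponent at the same part would come from a coordinate whose symbol
      lies strictly above that of \<open>j\<close>, against maximality.\<close>
    moreover have "?v j \<le> r" if r: "(r, lam ! j) \<in> ?I" for r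
    proof (rule ccontr)
      obtain i where i: "i < length lam" "a i \<noteq> 0" "?v i \<le> r" "lam ! j - r \<le> lam ! i - ?v i"
        using r by (auto simp: mem_elt_ideal_part mem_elt_ideal)
      assume "\<not> ?v j \<le> r"
      then have "?v i < ?v j" "lam ! j - ?v j \<le> lam ! i - ?v i"
        using i by auto
      then show False
        using \<open>j \<in> M\<close> i by (auto simp: M_def)
    qed
    ultimately have "(LEAST r. (r, lam ! j) \<in> ?I) = ?v j"
      by (rule Least_equality)
    then show ?thesis
      using j mem by (auto simp: e_def ideal_element_def)
  qed
  \<comment> \<open>The data for row \<open>j\<close>: source \<open>s\<close>, coefficient
    \<open>c\<close> and diagonal entry \<open>u\<close>. The last clause is the triangular shape: a
    row in \<open>M\<close> is only rescaled by a unit, any other row has diagonal 1 and draws on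
    \<open>M\<close>; with \<open>c = 0\<close> the source is a placeholder.\<close>
  define Q where "Q j s c u \<longleftrightarrow> s < length lam \<and> int p ^ (lam ! j) dvd c * int p ^ (lam ! s) \<and>
      [u * a j + c * a s = e j] (mod int p ^ (lam ! j)) \<and>
      (if j \<in> M then c = 0 \<and> \<not> int p dvd u else u = 1 \<and> (c = 0 \<or> s \<in> M))" for j s c u
  have "\<exists>s c u. Q j s c u" if j: "j < length lam" for j
  proof (cases "j \<in> M")
    case True
    then have "a j \<noteq> 0"
      by (simp add: M_def)
    obtain u where u: "[u * a j = int p ^ ?v j] (mod int p ^ (lam ! j))"
      using exists_coordinate_coefficient[OF p a j \<open>a j \<noteq> 0\<close> order_refl order_refl dvd_refl]
      by blast
    \<comment> \<open>Otherwise \<open>p ^ Suc (?v j)\<close> would divide \<open>u * a j\<close>,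
      hence also \<open>p ^ ?v j\<close>, since the modulus has exponent at least
      \<open>Suc (?v j)\<close>.\<close>
    have "\<not> int p dvd u"
    proof
      assume "int p dvd u"
      then have "int p ^ Suc (?v j) dvd u * a j"
        by (simp add: mult_dvd_mono multiplicity_dvd)
      moreover have "int p ^ Suc (?v j) dvd int p ^ (lam ! j)"
        using v_less[OF j \<open>a j \<noteq> 0\<close>] by (intro le_imp_power_dvd) simp
      ultimately have "int p ^ Suc (?v j) dvd int p ^ ?v j"
        using u by (meson cong_dvd_iff cong_dvd_modulus)
      then show False
        using p1 power_le_imp_le_exp[OF p1, of "Suc (?v j)" "?v j"] by (auto dest: zdvd_imp_le)
    qed
    with True j u have "Q j j 0 u"
      by (simp add: Q_def e_M)
    then show ?thesis
      by blast
  next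
    case False
    show ?thesis
    proof (cases "\<exists>r. (r, lam ! j) \<in> ?I")
      case True
      define r where "r = (LEAST r. (r, lam ! j) \<in> ?I)"
      have r: "(r, lam ! j) \<in> ?I"
        unfolding r_def using True by (rule LeastI_ex)
      \<comment> \<open>Minimality of \<open>r\<close> bounds the multiplicity of \<open>a j\<close>
        from below, so the correction \<open>e j - a j\<close> is divisible by \<open>p ^ r\<close>
        and can be supplied by a coordinate in \<open>M\<close>.\<close>
      have "int p ^ r dvd a j"
      proof (cases "a j = 0")
        case False
        then have "r \<le> ?v j"
          unfolding r_def by (intro Least_le coordinate_mem_elt_ideal_part p a j)
        then show ?thesis
          by (rule multiplicity_dvd')
      qed simp
      moreover have "e j = int p ^ r"
        using True j by (simp add: e_def ideal_element_def r_def)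
      ultimately have "int p ^ r dvd e j - a j"
        by simp
      moreover obtain i where i: "i \<in> M" "?v i \<le> r" "lam ! j - r \<le> lam ! i - ?v i"
        using below_M[OF r] by blast
      moreover have i': "i < length lam" "a i \<noteq> 0"
        using i(1) by (auto simp: M_def)
      ultimately obtain c where c: "[c * a i = e j - a j] (mod int p ^ (lam ! j))"
        "int p ^ (lam ! j) dvd c * int p ^ (lam ! i)"
        using exists_coordinate_coefficient[OF p a i'] by metis
      have "[a j + c * a i = e j] (mod int p ^ (lam ! j))"
        using cong_add[OF cong_refl[of "a j"] c(1)] by simp
      with c i i' \<open>j \<notin> M\<close> have "Q j i c 1"
        by (simp add: Q_def)
      then show ?thesis
        by blast
    next
      case no: False
      then have "a j = 0"
        using coordinate_mem_elt_ideal_part[OF p a j] by blast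
      moreover have "e j = 0"
        using no j by (simp add: e_def ideal_element_def)
      ultimately have "Q j j 0 1"
        using j \<open>j \<notin> M\<close> by (simp add: Q_def)
      then show ?thesis
        by blast
    qed
  qed
  then obtain s c u where "\<And>j. j < length lam \<Longrightarrow> Q j (s j) (c j) (u j)"
    by metis
  then have scu: "\<And>j. j < length lam \<Longrightarrow> s j < length lam"
    "\<And>j. j < length lam \<Longrightarrow> int p ^ (lam ! j) dvd c j * int p ^ (lam ! s j)"
    "\<And>j. j < length lam \<Longrightarrow> [u j * a j + c j * a (s j) = e j] (mod int p ^ (lam ! j))"
    "\<And>j. j < length lam \<Longrightarrow>
      if j \<in> M then c j = 0 \<and> \<not> int p dvd u j else u j = 1 \<and> (c j = 0 \<or> s j \<in> M)"
    unfolding Q_def by blast+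
  define h where
    "h = (\<lambda>x. \<lambda>j\<in>{..<length lam}. (u j * x j + c j * x (s j)) mod int p ^ (lam ! j))"
  have hom: "h \<in> hom ?A ?A"
    unfolding h_def by (rule coordinate_hom[OF p scu(1,2)])
  \<comment> \<open>Coordinates in \<open>M\<close> are recovered first, by cancelling units; then
    the terms added to the other rows agree and cancel. Finiteness turns injectivity into
    bijectivity.\<close>
  have "inj_on h (carrier ?A)"
  proof (rule inj_onI)
    fix x y assume x: "x \<in> carrier ?A" and y: "y \<in> carrier ?A" and "h x = h y"
    then have eq: "[u j * x j + c j * x (s j) = u j * y j + c j * y (s j)] (mod int p ^ (lam ! j))"
      if "j < length lam" for j
    proof -
      have "h x j = h y j"
        using \<open>h x = h y\<close> by simp
      with that show ?thesis
        by (simp add: h_def cong_def)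
    qed
    have cong_eq: "x j = y j" if "[x j = y j] (mod int p ^ (lam ! j))" "j < length lam" for j
      using that x y by (simp add: carrier_abelian_pgroup[OF p] cong_def)
    have eq_M: "x j = y j" if "j \<in> M" for j
    proof (rule cong_eq)
      show j: "j < length lam"
        using that by (simp add: M_def)
      have "c j = 0" "\<not> int p dvd u j"
        using scu(4)[OF j] that by simp_all
      then have "coprime (u j) (int p ^ (lam ! j))"
        using p by (simp add: prime_imp_coprime coprime_commute)
      then show "[x j = y j] (mod int p ^ (lam ! j))"
        using eq[OF j] \<open>c j = 0\<close> by (simp add: cong_mult_lcancel)
    qed
    have "x j = y j" if j: "j < length lam" for j
    proof (cases "j \<in> M")
      case False
      then have u: "u j = 1" and c: "c j * x (s j) = c j * y (s j)"
        using scu(4)[OF j] eq_M by auto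
      have "[x j = y j] (mod int p ^ (lam ! j))"
        using eq[OF j, unfolded u c] by (simp add: cong_add_rcancel)
      then show ?thesis
        using cong_eq j by blast
    qed (rule eq_M)
    then show "x = y"
      using x y by (intro extensionalityI[of _ "{..<length lam}"])
        (auto simp: carrier_abelian_pgroup[OF p])
  qed
  moreover have "h ` carrier ?A \<subseteq> carrier ?A"
    using hom_in_carrier[OF hom] by blast
  ultimately have "bij_betw h (carrier ?A) (carrier ?A)"
    using endo_inj_surj[OF finite_abelian_pgroup[OF p]] by (simp add: bij_betw_def)
  \<comment> \<open>Members of \<open>Bij\<close> are extensional on the carrier, hence the
    restriction.\<close>
  then have bij: "restrict h (carrier ?A) \<in> Bij (carrier ?A)"
    by (simp add: Bij_def cong: bij_betw_cong)
  interpret comm_group ?A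
    by (rule comm_group_abelian_pgroup)
  have "restrict h (carrier ?A) \<in> auto ?A"
    using bij hom_restrict[OF hom] by (simp add: auto_def)
  moreover have "h a = e"
    unfolding h_def by (rule abelian_pgroup_eqI[OF p e scu(3)])
  ultimately show ?thesis
    using a unfolding e_def by (intro bexI[of _ "restrict h (carrier ?A)"]) auto
qed

text \<open>Automorphisms shrink ideals in both directions along an orbit, so the ideal is constant
  there. Elements with equal ideals share their canonical element, and with it their orbit.\<close>

lemma aut_orbit_abelian_pgroup:
  assumes p: "prime p" and a: "a \<in> carrier (abelian_pgroup p lam)"
  shows "aut_orbit (abelian_pgroup p lam) a =
    {b \<in> carrier (abelian_pgroup p lam). elt_ideal_part p lam b = elt_ideal_part p lam a}"
proof -
  let ?A = "abelian_pgroup p lam"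
  interpret comm_group ?A
    by (rule comm_group_abelian_pgroup)
  have hom: "f b \<in> carrier ?A \<and> elt_ideal_part p lam (f b) \<subseteq> elt_ideal_part p lam b"
    if "f \<in> auto ?A" "b \<in> carrier ?A" for f b
    using that elt_ideal_hom_subset[OF p that(2)] hom_in_carrier
    by (fastforce simp: auto_def elt_ideal_part_def)
  have self: "b \<in> aut_orbit ?A b" if "b \<in> carrier ?A" for b
    unfolding aut_orbit_eq_image
    by (rule image_eqI[OF _ id_in_auto]) (simp add: that)
  have canonical: "aut_orbit ?A (ideal_element p lam (elt_ideal_part p lam b)) = aut_orbit ?A b"
    if b: "b \<in> carrier ?A" for b
  proof (rule aut_orbit_eqI[OF b])
    show "ideal_element p lam (elt_ideal_part p lam b) \<in> carrier ?A"
      by (intro ideal_element_carrier p part_order_ideal_elt_ideal_part)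
    show "ideal_element p lam (elt_ideal_part p lam b) \<in> aut_orbit ?A b"
      using exists_automorphism_to_ideal_element[OF p b] by (metis aut_orbit_eq_image imageI)
  qed
  show ?thesis
  proof (intro equalityI subsetI)
    fix b assume b: "b \<in> aut_orbit ?A a"
    then have bc: "b \<in> carrier ?A" "elt_ideal_part p lam b \<subseteq> elt_ideal_part p lam a"
      using hom a by (auto simp: aut_orbit_eq_image)
    \<comment> \<open>Symmetry of orbits stands in for applying the inverse automorphism.\<close>
    moreover have "a \<in> aut_orbit ?A b"
      using aut_orbit_eqI[OF a bc(1) b] self[OF a] by simp
    then have "elt_ideal_part p lam a \<subseteq> elt_ideal_part p lam b"
      using hom bc(1) by (auto simp: aut_orbit_eq_image)
    ultimately show "b \<in> {b \<in> carrier ?A. elt_ideal_part p lam b = elt_ideal_part p lam a}"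
      by blast
  next
    fix b assume "b \<in> {b \<in> carrier ?A. elt_ideal_part p lam b = elt_ideal_part p lam a}"
    then show "b \<in> aut_orbit ?A a"
      using canonical[OF a] canonical[of b] self[of b] by auto
  qed
qed

section \<open>The embedding of the orbit lattice\<close>

theorem theorem7p1:
  fixes p :: nat and lam :: "nat list"
  assumes "prime p" and "is_partition lam"
  shows "\<exists>F. (\<forall>a \<in> carrier (abelian_pgroup p lam).
                F (aut_orbit (abelian_pgroup p lam) a)
                  = ideal_subgroup p lam (elt_ideal_part p lam a)) \<and>
             lattice_embedding (orbit_lattice (abelian_pgroup p lam))
               (characteristic_lattice (abelian_pgroup p lam)) F"
proof -
  note p = assms(1)
  let ?A = "abelian_pgroup p lam"
  let ?L = "orbit_lattice ?A"
  let ?C = "characteristic_lattice ?A"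
  interpret comm_group ?A
    by (rule comm_group_abelian_pgroup)
  \<comment> \<open>An orbit comes without a representative. Its elements all have the same ideal,
    so the union over the orbit is that ideal.\<close>
  define J where "J U = (\<Union>a\<in>U. elt_ideal_part p lam a)" for U
  define F where "F U = ideal_subgroup p lam (J U)" for U
  have orbit: "aut_orbit ?A a =
      {b \<in> carrier ?A. elt_ideal_part p lam b = elt_ideal_part p lam a}"
    if "a \<in> carrier ?A" for a
    using aut_orbit_abelian_pgroup[OF p that] .
  have J_orbit: "J (aut_orbit ?A a) = elt_ideal_part p lam a" if "a \<in> carrier ?A" for a
    using orbit[OF that] that by (auto simp: J_def)
  have orbit_carrier: "U \<in> carrier ?L \<longleftrightarrow> (\<exists>a\<in>carrier ?A. U = aut_orbit ?A a)" for U
    by (auto simp: orbit_lattice_def orbits_def aut_orbit_def)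
  have ideal_J: "part_order_ideal lam (J U)" if "U \<in> carrier ?L" for U
    using that part_order_ideal_elt_ideal_part by (auto simp: orbit_carrier J_orbit)
  have eq: "eq ?L = (=)"
    by (simp add: orbit_lattice_def)
  have inj: "inj_on J (carrier ?L)"
  proof (rule inj_onI)
    fix U V assume "U \<in> carrier ?L" "V \<in> carrier ?L" "J U = J V"
    then obtain a b where "a \<in> carrier ?A" "b \<in> carrier ?A" "U = aut_orbit ?A a" "V = aut_orbit ?A b"
      "elt_ideal_part p lam a = elt_ideal_part p lam b"
      using J_orbit orbit_carrier by auto
    then show "U = V"
      by (simp add: orbit)
  qed
  have le: "U \<sqsubseteq>\<^bsub>?L\<^esub> V \<longleftrightarrow> J U \<subseteq> J V" if UV: "U \<in> carrier ?L" "V \<in> carrier ?L" for U V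
  proof -
    obtain a b where ab: "a \<in> carrier ?A" "U = aut_orbit ?A a" "b \<in> carrier ?A" "V = aut_orbit ?A b"
      using UV by (auto simp: orbit_carrier)
    have "U \<sqsubseteq>\<^bsub>?L\<^esub> V \<longleftrightarrow> (\<exists>b'\<in>V. \<exists>a'\<in>U. \<exists>h\<in>hom ?A ?A. h b' = a')"
      by (simp add: orbit_lattice_def)
    also have "\<dots> \<longleftrightarrow> elt_ideal_part p lam a \<subseteq> elt_ideal_part p lam b"
    proof
      assume "\<exists>b'\<in>V. \<exists>a'\<in>U. \<exists>h\<in>hom ?A ?A. h b' = a'"
      then obtain h b' where "h \<in> hom ?A ?A" "b' \<in> V" "h b' \<in> U"
        by blast
      then show "elt_ideal_part p lam a \<subseteq> elt_ideal_part p lam b"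
        using elt_ideal_hom_subset[OF p, of b' lam h] ab
        by (auto simp: orbit elt_ideal_part_def)
    next
      assume "elt_ideal_part p lam a \<subseteq> elt_ideal_part p lam b"
      then obtain h where "h \<in> hom ?A ?A" "h b = a"
        using exists_hom_of_elt_ideal_part_subset[OF p ab(3,1)] by blast
      moreover have "a \<in> U" "b \<in> V"
        using ab orbit by auto
      ultimately show "\<exists>b'\<in>V. \<exists>a'\<in>U. \<exists>h\<in>hom ?A ?A. h b' = a'"
        by blast
    qed
    finally show ?thesis
      using ab J_orbit by simp
  qed
  have realize: "\<exists>W\<in>carrier ?L. J W = I" if I: "part_order_ideal lam I" for I
    using ideal_element[OF p I] J_orbit orbit_carrier by metis
  note lattice = lattice_of_sets[OF eq inj le
      realize[OF part_order_ideal_Un[OF ideal_J ideal_J]]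
      realize[OF part_order_ideal_Int[OF ideal_J ideal_J]]]
  have "F \<in> carrier ?L \<rightarrow> carrier ?C"
    using characteristic_subgroup_ideal_subgroup[OF p]
    by (auto simp: F_def characteristic_lattice_def)
  moreover have "inj_on F (carrier ?L)"
  proof (rule inj_onI)
    fix U V assume UV: "U \<in> carrier ?L" "V \<in> carrier ?L" and FF: "F U = F V"
    \<comment> \<open>The ideal can be read off from the subgroup: a representative \<open>a\<close>
      of \<open>U\<close> lies in \<open>F U = F V\<close>, so its ideal, which is
      \<open>J U\<close>, is contained in \<open>J V\<close>.\<close>
    have sub: "J U \<subseteq> J V" if U: "U \<in> carrier ?L" and FF: "F U = F V" for U V
    proof -
      obtain a where a: "a \<in> carrier ?A" "J U = elt_ideal_part p lam a"
        using U J_orbit orbit_carrier by auto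
      then have "a \<in> F V"
        unfolding FF[symmetric] by (simp add: F_def ideal_subgroup_def)
      with a show ?thesis
        by (simp add: F_def ideal_subgroup_def)
    qed
    have "J U = J V"
      using sub[OF UV(1) FF] sub[OF UV(2) FF[symmetric]] by blast
    then show "U = V"
      using inj UV by (simp add: inj_on_def)
  qed
  moreover have "join_pres ?L ?C F"
    using lattice(1,2) lattice_characteristic characteristic_join ideal_J
      characteristic_subgroup_ideal_subgroup[OF p]
    by (simp add: join_pres_def F_def ideal_subgroup_Un[OF p])
  moreover have "meet_pres ?L ?C F"
    using lattice(1,3) lattice_characteristic characteristic_meet
      characteristic_subgroup_ideal_subgroup[OF p]
    by (simp add: meet_pres_def F_def ideal_subgroup_Int)
  ultimately show ?thesis
    using J_orbit by (intro exI[of _ F]) (simp add: lattice_embedding_def F_def)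
qed

end
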